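(* Let $f$ and $g$ be two functions which are nonzero at positive integers. Put $b_0=f(1)g(1)$ and, for every integer $n\ge 1$, $$a_n=-f(n)^2,\qquad b_n=\frac{f(n+1)g(n+1)+f(n)g(n-1)}{g(n)}.$$ Define sequences $(p_n)_{n\ge -1}$ and $(q_n)_{n\ge -1}$ by $p_{-1}=1$, $p_0=b_0$, $q_{-1}=0$, $q_0=1$ and, for all $n\ge 1$, $$p_n=b_np_{n-1}+a_np_{n-2},\qquad q_n=b_nq_{n-1}+a_nq_{n-2}.$$ Let $F_n=\prod_{i=1}^{n+1}f(i)$, with $F_{-1}=1$ and $F_0=f(1)$. Then: 1. For all $n\ge -1$, $p_n=F_n\,g(n+1)$. 2. For all $n\ge 0$, $$\frac{q_n}{p_n}=\sum_{i=0}^{n}\frac{1}{f(i+1)\,g(i)\,g(i+1)}.$$ 3. The limit $L$ of the continued fraction with partial numerators $a_n$ and partial denominators $b_n$ is given by $$\frac{1}{L}=\sum_{n=0}^{\infty}\frac{1}{f(n+1)\,g(n)\,g(n+1)}.$$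
   Context: The continued fraction with partial numerators $a_n$ ($n\ge1$) and partial denominators $b_n$ ($n\ge 0$) is $b_0+\cfrac{a_1}{b_1+\cfrac{a_2}{b_2+\cdots}}$. Its $n$-th convergent is $p_n/q_n$, where $p_n,q_n$ are given by the recurrences in the claim, and its limit is $L=\lim_{n\to\infty}p_n/q_n$. The functions $f$ and $g$ are evaluated only at integers.
   Formalization: The condition g(0) = 1 is added; without it the claim fails, since item 1 at n = -1 says 1 = g(0) (e.g. f = 1, g = 2 constant). Item 3 is read as: the continued fraction has limit L exactly when the series sums to 1/L, with L = 0 and L = infinity treated separately. *)

theory Defs
  imports Complex_Main
begin

text \<open>
  Limits of continued fractions, in terms of the numerators \<open>p\<close> and denominators \<open>q\<close> of the
  convergents. Both are indexed by \<open>int\<close> because the recurrences start at index \<open>-1\<close>.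
  Since \<open>x / 0 = 0\<close> in HOL, convergents with vanishing denominator are treated explicitly:
  a finite limit requires that only finitely many of them occur, whereas for the limit
  \<open>\<infinity>\<close> such a convergent counts as the point at infinity.
\<close>

definition cf_limit :: "(int \<Rightarrow> 'a) \<Rightarrow> (int \<Rightarrow> 'a) \<Rightarrow> 'a::real_normed_field \<Rightarrow> bool" where
  "cf_limit p q L \<longleftrightarrow>
     (\<forall>\<^sub>F n in sequentially. q (int n) \<noteq> 0) \<and>
     (\<lambda>n. p (int n) / q (int n)) \<longlonglongrightarrow> L"

definition cf_limit_infinity :: "(int \<Rightarrow> 'a::real_normed_field) \<Rightarrow> (int \<Rightarrow> 'a) \<Rightarrow> bool" where
  "cf_limit_infinity p q \<longleftrightarrow>
     (\<forall>R. \<forall>\<^sub>F n in sequentially. q (int n) = 0 \<or> R < norm (p (int n) / q (int n)))"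

end

theory Submission
  imports Defs
begin

text \<open>
  The denominators \<open>b n\<close> are chosen so that \<open>n \<mapsto> F n * g (n + 1)\<close> solves the three-term
  recurrence. Once one solution \<open>p\<close> is known explicitly, a second one is found by reduction of
  order: in \<open>q n = p n * S n\<close> the increments of \<open>S\<close> satisfy a first-order recurrence, because
  the determinant \<open>p (n - 1) * q n - p n * q (n - 1)\<close> is multiplied by \<open>- a n = (f n)\<^sup>2\<close> at each
  step. Hence \<open>q n / p n\<close> telescopes, with increments
  \<open>1 / (f (n + 1) * g n * g (n + 1))\<close>. Lemma \<open>convergents_closed_form\<close> carries this algebra.

  Consequently the convergents \<open>p n / q n\<close> are the reciprocals of the partial sums of the series,
  and the limit statements say that inversion is a homeomorphism of the field extended by a point at infinity:
  it maps nonzero \<open>L\<close> to \<open>1 / L\<close> and exchanges \<open>0\<close> and \<open>\<infinity>\<close>. The three lemmas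
  \<open>cf_limit_iff_reciprocal\<close>, \<open>cf_limit_infinity_iff_reciprocal\<close> and \<open>cf_limit_zero_iff_reciprocal\<close>
  treat these three cases; in each of them \<open>p n \<noteq> 0\<close> ensures that \<open>q n\<close> vanishes
  exactly when the partial sum does.
\<close>

context
  fixes p q :: "int \<Rightarrow> 'a::real_normed_field" and S :: "nat \<Rightarrow> 'a"
  assumes p_nonzero: "\<And>n. p (int n) \<noteq> 0"
    and ratio: "\<And>n. q (int n) / p (int n) = S n"
begin

lemma q_zero_iff: "q (int n) = 0 \<longleftrightarrow> S n = 0"
  using p_nonzero[of n] ratio[of n] by auto

lemma convergent_eq_inverse: "p (int n) / q (int n) = inverse (S n)"
  by (simp flip: ratio)

lemma cf_limit_iff_reciprocal:
  assumes "L \<noteq> 0"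
  shows "cf_limit p q L \<longleftrightarrow> S \<longlonglongrightarrow> 1 / L"
proof
  assume "cf_limit p q L"
  then have "(\<lambda>n. inverse (S n)) \<longlonglongrightarrow> L"
    by (simp add: cf_limit_def convergent_eq_inverse)
  from tendsto_inverse[OF this assms] show "S \<longlonglongrightarrow> 1 / L"
    by (simp add: inverse_eq_divide)
next
  assume S: "S \<longlonglongrightarrow> 1 / L"
  then have "\<forall>\<^sub>F n in sequentially. S n \<noteq> 0"
    using assms by (simp add: tendsto_imp_eventually_ne)
  moreover have "(\<lambda>n. inverse (S n)) \<longlonglongrightarrow> L"
    using tendsto_inverse[OF S] assms by simp
  ultimately show "cf_limit p q L"
    by (simp add: cf_limit_def convergent_eq_inverse q_zero_iff)
qed

lemma cf_limit_infinity_iff_reciprocal: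
  "cf_limit_infinity p q \<longleftrightarrow> S \<longlonglongrightarrow> 0"
proof
  assume inf: "cf_limit_infinity p q"
  show "S \<longlonglongrightarrow> 0"
  proof (rule tendstoI)
    fix e :: real
    assume "e > 0"
    have "\<forall>\<^sub>F n in sequentially. S n = 0 \<or> inverse e < inverse (norm (S n))"
      using inf by (simp add: cf_limit_infinity_def convergent_eq_inverse q_zero_iff norm_inverse)
    then show "\<forall>\<^sub>F n in sequentially. dist (S n) 0 < e"
    proof eventually_elim
      case (elim n)
      then show ?case
        using \<open>e > 0\<close> by (cases "S n = 0") auto
    qed
  qed
next
  assume S: "S \<longlonglongrightarrow> 0"
  show "cf_limit_infinity p q"
    unfolding cf_limit_infinity_def
  proof
    fix R :: real
    have "\<forall>\<^sub>F n in sequentially. norm (S n) < inverse (\<bar>R\<bar> + 1)"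
      using tendstoD[OF S, of "inverse (\<bar>R\<bar> + 1)"] by simp
    then show "\<forall>\<^sub>F n in sequentially. q (int n) = 0 \<or> R < norm (p (int n) / q (int n))"
    proof eventually_elim
      case (elim n)
      show ?case
      proof (cases "S n = 0")
        case False
        then have "\<bar>R\<bar> + 1 < inverse (norm (S n))"
          using elim less_imp_inverse_less[of "norm (S n)" "inverse (\<bar>R\<bar> + 1)"] by simp
        then show ?thesis
          using abs_ge_self[of R] by (simp add: convergent_eq_inverse norm_inverse)
      qed (simp add: q_zero_iff)
    qed
  qed
qed

lemma cf_limit_zero_iff_reciprocal:
  "cf_limit p q 0 \<longleftrightarrow> filterlim S at_infinity sequentially"
proof -
  have "cf_limit p q 0 \<longleftrightarrow> filterlim (\<lambda>n. inverse (S n)) (at 0) sequentially"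
    by (auto simp: cf_limit_def convergent_eq_inverse q_zero_iff filterlim_at)
  also have "\<dots> \<longleftrightarrow> filterlim S at_infinity sequentially"
    by (rule filterlim_inverse_at_iff)
  finally show ?thesis .
qed

end

text \<open>
  Solutions of the recurrence are determined by two consecutive values, so it suffices to check
  the closed forms at the indices \<open>-1\<close> and \<open>0\<close>, where the sum is empty
  respectively has one term, and to propagate two neighbouring indices at a time.
\<close>
lemma convergents_closed_form:
  fixes f g a b p q F :: "int \<Rightarrow> 'a::field"
  assumes f_nonzero: "\<And>n. n \<ge> 1 \<Longrightarrow> f n \<noteq> 0"
    and g_nonzero: "\<And>n. n \<ge> 0 \<Longrightarrow> g n \<noteq> 0"
    and g_0: "g 0 = 1"
    and a: "\<And>n. n \<ge> 1 \<Longrightarrow> a n = - ((f n)^2)"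
    and b: "\<And>n. n \<ge> 1 \<Longrightarrow> b n = (f (n + 1) * g (n + 1) + f n * g (n - 1)) / g n"
    and p_init: "p (-1) = 1" "p 0 = f 1 * g 1"
    and q_init: "q (-1) = 0" "q 0 = 1"
    and p_rec: "\<And>n. n \<ge> 1 \<Longrightarrow> p n = b n * p (n - 1) + a n * p (n - 2)"
    and q_rec: "\<And>n. n \<ge> 1 \<Longrightarrow> q n = b n * q (n - 1) + a n * q (n - 2)"
    and F: "\<And>n. n \<ge> -1 \<Longrightarrow> F n = (\<Prod>i\<in>{1..n + 1}. f i)"
    and "n \<ge> -1"
  shows "p n = F n * g (n + 1) \<and>
         q n = p n * (\<Sum>i\<in>{0..n}. 1 / (f (i + 1) * g i * g (i + 1)))"
proof -
  define t where "t i = 1 / (f (i + 1) * g i * g (i + 1))" for i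
  define S where "S m = (\<Sum>i\<in>{0..m}. t i)" for m
  have F_step: "F m = f (m + 1) * F (m - 1)" if "m \<ge> 0" for m
  proof -
    have "{1..m + 1} = insert (m + 1) {1..m}"
      using that by auto
    then show ?thesis
      using that by (simp add: F)
  qed
  have S_step: "S m = S (m - 1) + t m" if "m \<ge> 0" for m
  proof -
    have "{0..m} = insert m {0..m - 1}"
      using that by auto
    then show ?thesis
      by (simp add: S_def)
  qed
  let ?P = "\<lambda>m. p m = F m * g (m + 1) \<and> q m = p m * S m"
  have "?P (int k - 1) \<and> ?P (int k)" for k
  proof (induction k)
    case 0
    show ?case
      using p_init q_init g_0 f_nonzero[of 1] g_nonzero[of 1]
      by (simp add: F S_def t_def)
  next
    case (Suc k)
    define m where "m = int k + 1"
    have m: "m \<ge> 1" by (simp add: m_def)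
    have p1: "p (m - 1) = F (m - 1) * g m" and q1: "q (m - 1) = p (m - 1) * S (m - 1)"
      and p2: "p (m - 2) = F (m - 2) * g (m - 1)" and q2: "q (m - 2) = p (m - 2) * S (m - 2)"
      using Suc.IH by (simp_all add: m_def)
    have nz: "f m \<noteq> 0" "f (m + 1) \<noteq> 0" "g (m - 1) \<noteq> 0" "g m \<noteq> 0" "g (m + 1) \<noteq> 0"
      using m by (simp_all add: f_nonzero g_nonzero)
    have F1: "F (m - 1) = f m * F (m - 2)" and F0: "F m = f (m + 1) * F (m - 1)"
      using F_step[of "m - 1"] F_step[of m] m by simp_all
    have pm: "p m = F m * g (m + 1)"
      unfolding p_rec[OF m] p1 p2 a[OF m] b[OF m] F0 F1
      using nz by (simp add: field_simps power2_eq_square)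
    \<comment> \<open>Both sides equal \<open>F (m - 1) / g m\<close>; this is the first-order recurrence for the
      increments \<open>t\<close>.\<close>
    have increment: "p m * t m = - a m * p (m - 2) * t (m - 1)"
      unfolding pm p2 a[OF m] t_def F0 F1
      using nz by (simp add: field_simps power2_eq_square)
    have S2: "S (m - 2) = S (m - 1) - t (m - 1)"
      using S_step[of "m - 1"] m by simp
    have "q m = (b m * p (m - 1) + a m * p (m - 2)) * S (m - 1) - a m * p (m - 2) * t (m - 1)"
      unfolding q_rec[OF m] q1 q2 S2 by (simp add: algebra_simps)
    also have "\<dots> = p m * S (m - 1) + p m * t m"
      unfolding increment p_rec[OF m, symmetric] by simp
    also have "\<dots> = p m * S m"
      using S_step[of m] m by (simp add: algebra_simps)
    finally show ?case
      using pm Suc.IH by (simp add: m_def add.commute)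
  qed
  from this[of "nat (n + 1)"] show ?thesis
    using \<open>n \<ge> -1\<close> by (simp add: S_def t_def)
qed

theorem mainTheorem1:
  fixes f g a b p q F :: "int \<Rightarrow> 'a::real_normed_field"
  assumes f_nonzero: "\<And>n. n \<ge> 1 \<Longrightarrow> f n \<noteq> 0"
    and g_nonzero: "\<And>n. n \<ge> 1 \<Longrightarrow> g n \<noteq> 0"
    and g_0: "g 0 = 1"
    and b_0: "b 0 = f 1 * g 1"
    and a: "\<And>n. n \<ge> 1 \<Longrightarrow> a n = - ((f n)^2)"
    and b: "\<And>n. n \<ge> 1 \<Longrightarrow> b n = (f (n + 1) * g (n + 1) + f n * g (n - 1)) / g n"
    and p_init: "p (-1) = 1" "p 0 = b 0"
    and q_init: "q (-1) = 0" "q 0 = 1"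
    and p_rec: "\<And>n. n \<ge> 1 \<Longrightarrow> p n = b n * p (n - 1) + a n * p (n - 2)"
    and q_rec: "\<And>n. n \<ge> 1 \<Longrightarrow> q n = b n * q (n - 1) + a n * q (n - 2)"
    and F: "\<And>n. n \<ge> -1 \<Longrightarrow> F n = (\<Prod>i\<in>{1..n + 1}. f i)"
  shows "(\<forall>n\<ge>-1. p n = F n * g (n + 1)) \<and>
    (\<forall>n\<ge>0. q n / p n = (\<Sum>i\<in>{0..n}. 1 / (f (i + 1) * g i * g (i + 1)))) \<and>
    (\<forall>L. L \<noteq> 0 \<longrightarrow>
       (cf_limit p q L \<longleftrightarrow>
        (\<lambda>n. 1 / (f (int n + 1) * g (int n) * g (int n + 1))) sums (1 / L))) \<and>
    (cf_limit_infinity p q \<longleftrightarrow>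
       (\<lambda>n. 1 / (f (int n + 1) * g (int n) * g (int n + 1))) sums 0) \<and>
    (cf_limit p q 0 \<longleftrightarrow>
       filterlim (\<lambda>N. \<Sum>n<N. 1 / (f (int n + 1) * g (int n) * g (int n + 1)))
         at_infinity sequentially)"
proof -
  let ?t = "\<lambda>i. 1 / (f (i + 1) * g i * g (i + 1))"
  define S where "S N = (\<Sum>n<N. ?t (int n))" for N :: nat
  have g_nz: "g n \<noteq> 0" if "n \<ge> 0" for n
    using that g_nonzero[of n] g_0 by (cases "n = 0") auto
  have p0: "p 0 = f 1 * g 1"
    by (simp add: p_init b_0)
  note closed = convergents_closed_form[of f g a b p q F, OF f_nonzero g_nz g_0 a b p_init(1) p0
      q_init p_rec q_rec F]
  have p_eq: "p n = F n * g (n + 1)" if "n \<ge> -1" for n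
    using closed that by blast
  have p_nz: "p n \<noteq> 0" if "n \<ge> 0" for n
    using that by (auto simp: p_eq F g_nz f_nonzero)
  have ratio: "q n / p n = (\<Sum>i\<in>{0..n}. ?t i)" if "n \<ge> 0" for n
  proof -
    have "q n = p n * (\<Sum>i\<in>{0..n}. ?t i)"
      using closed that by simp
    then show ?thesis
      using p_nz[OF that] by simp
  qed
  have S: "q (int n) / p (int n) = S (Suc n)" for n
  proof -
    have "(\<Sum>i\<in>{0..int n}. ?t i) = (\<Sum>i\<in>int ` {..<Suc n}. ?t i)"
      by (simp add: lessThan_Suc_atMost atMost_atLeast0 image_int_atLeastAtMost)
    also have "\<dots> = S (Suc n)"
      unfolding S_def by (subst sum.reindex) (auto simp: o_def)
    finally show ?thesis
      by (simp add: ratio)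
  qed
  have p_nz': "p (int n) \<noteq> 0" for n
    by (simp add: p_nz)
  have sums_iff: "(\<lambda>n. ?t (int n)) sums l \<longleftrightarrow> (\<lambda>n. S (Suc n)) \<longlonglongrightarrow> l" for l
    unfolding sums_def S_def[symmetric] by (rule filterlim_sequentially_Suc[symmetric])
  have inf_iff: "filterlim S at_infinity sequentially \<longleftrightarrow>
      filterlim (\<lambda>n. S (Suc n)) at_infinity sequentially"
    by (rule filterlim_sequentially_Suc[symmetric])
  show ?thesis
    unfolding sums_iff S_def[symmetric] inf_iff
    using p_eq ratio cf_limit_iff_reciprocal[of p q "\<lambda>n. S (Suc n)", OF p_nz' S]
      cf_limit_infinity_iff_reciprocal[of p q "\<lambda>n. S (Suc n)", OF p_nz' S]
      cf_limit_zero_iff_reciprocal[of p q "\<lambda>n. S (Suc n)", OF p_nz' S]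
    by simp
qed

end
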